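(* Let $T$ be a posinormal operator on a complex Hilbert space $\mathcal{H}$ having closed range. The following are equivalent: (a) $0\notin\sigma_R\big(T|_{\mathcal{N}(T)^\perp}\big)$; (b) $T|_{\mathcal{N}(T)^\perp}$ is invertible; (c) $T$ is coposinormal; (d) $0$ is not a limit point of the spectrum $\sigma(T)$.
   Context: An operator is a bounded linear transformation of a Hilbert space into itself. $\mathcal{N}(T)$ and $\mathcal{R}(T)$ denote the kernel and range of $T$. An operator $T$ is posinormal if $\mathcal{R}(T)\subseteq\mathcal{R}(T^* )$, and coposinormal if $T^*$ is posinormal. If $T$ is posinormal then $\mathcal{N}(T)$ reduces $T$, and $T|_{\mathcal{N}(T)^\perp}$ is regarded as an operator on $\mathcal{N}(T)^\perp$. The residual spectrum $\sigma_R(S)$ of an operator $S$ is the set of $\lambda\in\mathbb{C}$ such that $S-\lambda I$ is injective but its range is not dense. *)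

theory Defs
  imports "HOL-Analysis.Analysis"
begin

text \<open>
  The libraries only provide real inner product spaces. A complex inner product space is
  given here together with its underlying real inner product space, whose inner product is
  the real part of the complex one. So the norm is the usual
  \<open>\<parallel>x\<parallel> = sqrt (Re \<langle>x, x\<rangle>)\<close>, and positive definiteness of the
  complex inner product is inherited from the real one. The complex inner product is linear
  in its first argument.
\<close>

class complex_inner = real_inner +
  fixes scaleC :: "complex \<Rightarrow> 'a \<Rightarrow> 'a" (infixr "*\<^sub>C" 75)
    and cinner :: "'a \<Rightarrow> 'a \<Rightarrow> complex"
  assumes scaleC_add_right: "c *\<^sub>C (x + y) = c *\<^sub>C x + c *\<^sub>C y"
    and scaleC_add_left: "(c + d) *\<^sub>C x = c *\<^sub>C x + d *\<^sub>C x"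
    and scaleC_scaleC: "c *\<^sub>C (d *\<^sub>C x) = (c * d) *\<^sub>C x"
    and scaleR_scaleC: "r *\<^sub>R x = complex_of_real r *\<^sub>C x"
    and cinner_commute: "cinner x y = cnj (cinner y x)"
    and cinner_add_left: "cinner (x + y) z = cinner x z + cinner y z"
    and cinner_scaleC_left: "cinner (c *\<^sub>C x) y = c * cinner x y"
    and inner_eq_Re_cinner: "x \<bullet> y = Re (cinner x y)"

class complex_hilbert = complex_inner + complete_space

lemma scaleC_one: "1 *\<^sub>C x = (x :: 'a :: complex_inner)"
  using scaleR_scaleC[of 1 x] by simp

lemma cinner_self_eq_norm: "cinner x x = complex_of_real ((norm x)\<^sup>2)"
proof (rule complex_eqI)
  show "Re (cinner x x) = Re (complex_of_real ((norm x)\<^sup>2))"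
    by (simp add: power2_norm_eq_inner inner_eq_Re_cinner)
  have "Im (cinner x x) = - Im (cinner x x)"
    by (subst cinner_commute) simp
  then show "Im (cinner x x) = Im (complex_of_real ((norm x)\<^sup>2))"
    by simp
qed

definition ortho_compl :: "'a :: complex_inner set \<Rightarrow> 'a set" where
  "ortho_compl M = {x. \<forall>y\<in>M. cinner x y = 0}"

text \<open>
  An operator on a closed subspace \<open>M\<close> is represented by a function on the ambient type, of
  which only the values on \<open>M\<close> matter. In particular, the restriction of an operator \<open>T\<close> to
  an invariant subspace \<open>M\<close>, as an operator on \<open>M\<close>, is represented by \<open>T\<close> itself together
  with \<open>M\<close>. Operators on the whole space are the case \<open>M = UNIV\<close>.
\<close>

definition operator_on :: "'a :: complex_inner set \<Rightarrow> ('a \<Rightarrow> 'a) \<Rightarrow> bool" where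
  "operator_on M S \<longleftrightarrow>
     S ` M \<subseteq> M \<and>
     (\<forall>x\<in>M. \<forall>y\<in>M. S (x + y) = S x + S y) \<and>
     (\<forall>c. \<forall>x\<in>M. S (c *\<^sub>C x) = c *\<^sub>C S x) \<and>
     (\<exists>K. \<forall>x\<in>M. norm (S x) \<le> K * norm x)"

lemma operator_on_UNIV_iff:
  "operator_on UNIV T \<longleftrightarrow> bounded_linear T \<and> (\<forall>c x. T (c *\<^sub>C x) = c *\<^sub>C T x)"
  unfolding operator_on_def bounded_linear_def bounded_linear_axioms_def linear_iff
  by (auto simp: scaleR_scaleC mult.commute)

definition invertible_on :: "'a :: complex_inner set \<Rightarrow> ('a \<Rightarrow> 'a) \<Rightarrow> bool" where
  "invertible_on M S \<longleftrightarrow>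
     operator_on M S \<and> (\<exists>R. operator_on M R \<and> (\<forall>x\<in>M. R (S x) = x \<and> S (R x) = x))"

definition spectrum_on :: "'a :: complex_inner set \<Rightarrow> ('a \<Rightarrow> 'a) \<Rightarrow> complex set" where
  "spectrum_on M S = {l. \<not> invertible_on M (\<lambda>x. S x - l *\<^sub>C x)}"

text \<open>The range of an operator on \<open>M\<close> lies in \<open>M\<close>, and its density is density in \<open>M\<close>.\<close>

definition residual_spectrum_on :: "'a :: complex_inner set \<Rightarrow> ('a \<Rightarrow> 'a) \<Rightarrow> complex set" where
  "residual_spectrum_on M S =
     {l. inj_on (\<lambda>x. S x - l *\<^sub>C x) M \<and> \<not> M \<subseteq> closure ((\<lambda>x. S x - l *\<^sub>C x) ` M)}"

abbreviation operator :: "('a :: complex_inner \<Rightarrow> 'a) \<Rightarrow> bool" where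
  "operator \<equiv> operator_on UNIV"

abbreviation spectrum :: "('a :: complex_inner \<Rightarrow> 'a) \<Rightarrow> complex set" where
  "spectrum \<equiv> spectrum_on UNIV"

definition null_space :: "('a :: complex_inner \<Rightarrow> 'a) \<Rightarrow> 'a set" where
  "null_space T = {x. T x = 0}"

definition hadjoint :: "('a :: complex_hilbert \<Rightarrow> 'a) \<Rightarrow> 'a \<Rightarrow> 'a" where
  "hadjoint T = (THE S. operator S \<and> (\<forall>x y. cinner (T x) y = cinner x (S y)))"

definition posinormal :: "('a :: complex_hilbert \<Rightarrow> 'a) \<Rightarrow> bool" where
  "posinormal T \<longleftrightarrow> range T \<subseteq> range (hadjoint T)"

definition coposinormal :: "('a :: complex_hilbert \<Rightarrow> 'a) \<Rightarrow> bool" where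
  "coposinormal T \<longleftrightarrow> posinormal (hadjoint T)"

end

theory Submission
  imports Defs
begin

text \<open>
  Let \<open>M\<close> be the orthogonal complement of the kernel of \<open>T\<close>. Each of the four conditions is
  equivalent to \<open>range T = M\<close>.

  The range of the adjoint is orthogonal to the kernel, so posinormality gives
  \<open>range T \<subseteq> M\<close> and \<open>T\<close> maps \<open>M\<close> into itself, injectively and with the same range as on the
  whole space. Since this range is closed, it is dense in \<open>M\<close> only if it equals \<open>M\<close>, which
  settles the residual spectrum. By the open mapping theorem
  (\<open>closed_range_bounded_preimage\<close>), \<open>T\<close> is bounded below on \<open>M\<close>, so a surjective restriction
  has a bounded inverse.

  If \<open>T\<close> is also coposinormal, then \<open>T\<close> and its adjoint have the same range. As this range is
  closed, it is the whole of \<open>M\<close>, because a vector orthogonal to the range of the adjoint lies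
  in the kernel. Conversely, if the range of \<open>T\<close> is \<open>M\<close>, then it contains the range of the
  adjoint.

  For the spectrum, suppose that \<open>T - l\<close> is invertible for all small \<open>l \<noteq> 0\<close>, and let \<open>y\<close> be
  in \<open>M\<close>. The solution \<open>x\<close> of \<open>T x - l *\<^sub>C x = y\<close> is in \<open>M\<close> again, because \<open>l *\<^sub>C x = T x - y\<close>,
  and the lower bound of \<open>T\<close> on \<open>M\<close> bounds \<open>x\<close> independently of \<open>l\<close>. So \<open>T x\<close> tends to \<open>y\<close> as
  \<open>l\<close> tends to \<open>0\<close>, and \<open>y\<close> lies in the closed range of \<open>T\<close>. Conversely, if \<open>T\<close> maps \<open>M\<close> onto
  \<open>M\<close>, then \<open>T - l\<close> is a small perturbation of an invertible operator on \<open>M\<close> and multiplication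
  by \<open>- l\<close> on the kernel, hence invertible for small \<open>l \<noteq> 0\<close>
  (\<open>range_imp_zero_not_limpt_spectrum\<close>).
\<close>

section \<open>Orthogonal projection and Riesz representation in real Hilbert spaces\<close>

text \<open>
  The nearest point of \<open>S\<close> to \<open>x\<close> exists because the sets of near-minimizers of the distance
  are nested and, by the parallelogram law, shrink to a point.
\<close>

lemma orthogonal_projection_exists:
  fixes S :: "'a :: {real_inner, complete_space} set"
  assumes "subspace S" and "closed S"
  obtains p where "p \<in> S" and "\<And>s. s \<in> S \<Longrightarrow> (x - p) \<bullet> s = 0"
proof -
  let ?Q = "\<lambda>s. (norm (x - s))\<^sup>2"
  define D where "D = Inf (?Q ` S)"
  have "0 \<in> S" using assms(1) by (rule subspace_0)
  have bdd: "bdd_below (?Q ` S)" by (rule bdd_belowI[of _ 0]) auto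
  have D_le: "D \<le> ?Q s" if "s \<in> S" for s
    unfolding D_def using bdd that by (simp add: cInf_lower)
  define C where "C n = {s \<in> S. ?Q s \<le> D + 1 / real (Suc n)}" for n
  have C_closed: "closed (C n)" for n
  proof -
    have "C n = S \<inter> {s. ?Q s \<le> D + 1 / real (Suc n)}" unfolding C_def by auto
    moreover have "closed {s. ?Q s \<le> D + 1 / real (Suc n)}"
      by (intro closed_Collect_le continuous_intros)
    ultimately show ?thesis using assms(2) by auto
  qed
  have C_ne: "C n \<noteq> {}" for n
  proof -
    have "Inf (?Q ` S) < D + 1 / real (Suc n)" unfolding D_def by simp
    then obtain q where "q \<in> ?Q ` S" "q < D + 1 / real (Suc n)"
      using \<open>0 \<in> S\<close> by (metis cInf_lessD empty_iff image_is_empty)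
    then show ?thesis unfolding C_def by force
  qed
  have C_dec: "C n \<subseteq> C m" if "m \<le> n" for m n
  proof -
    have "1 / real (Suc n) \<le> 1 / real (Suc m)" using that by (simp add: frac_le)
    then show ?thesis unfolding C_def by fastforce
  qed
  \<comment> \<open>The midpoint of two near-minimizers is no closer to \<open>x\<close> than the infimum.\<close>
  have C_diam: "(norm (u - v))\<^sup>2 \<le> 4 / real (Suc n)" if "u \<in> C n" "v \<in> C n" for u v n
  proof -
    have "(1/2) *\<^sub>R (u + v) \<in> S"
      using that assms(1) unfolding C_def by (auto intro: subspace_scale subspace_add)
    from D_le[OF this] have "4 * D \<le> 4 * ?Q ((1/2) *\<^sub>R (u + v))" by simp
    moreover have "(norm (u - v))\<^sup>2 = 2 * ?Q u + 2 * ?Q v - 4 * ?Q ((1/2) *\<^sub>R (u + v))"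
      by (simp add: power2_norm_eq_inner inner_add_left inner_add_right inner_diff_left
          inner_diff_right inner_commute algebra_simps)
    ultimately show ?thesis using that unfolding C_def by auto
  qed
  have C_small: "\<exists>n. \<forall>u\<in>C n. \<forall>v\<in>C n. dist u v < e" if "e > 0" for e
  proof -
    obtain n where n: "inverse (real (Suc n)) < e\<^sup>2 / 4"
      using reals_Archimedean[of "e\<^sup>2 / 4"] \<open>e > 0\<close> by auto
    have "dist u v < e" if "u \<in> C n" "v \<in> C n" for u v
    proof -
      have "(norm (u - v))\<^sup>2 < e\<^sup>2"
        using C_diam[OF that] n by (simp add: inverse_eq_divide)
      then show ?thesis
        using \<open>e > 0\<close> by (simp add: dist_norm power_less_imp_less_base)
    qed
    then show ?thesis by blast
  qed
  obtain p where p: "\<And>n. p \<in> C n"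
    using decreasing_closed_nest[of C, OF C_closed C_ne C_dec C_small] by blast
  have "p \<in> S" using p unfolding C_def by auto
  have "?Q p \<le> D"
  proof (rule ccontr)
    assume "\<not> ?Q p \<le> D"
    then obtain n where "inverse (real (Suc n)) < ?Q p - D"
      using reals_Archimedean[of "?Q p - D"] by auto
    then show False using p[of n] unfolding C_def by (simp add: inverse_eq_divide)
  qed
  have "(x - p) \<bullet> s = 0" if "s \<in> S" for s
  proof (cases "s = 0")
    case False
    \<comment> \<open>Moving from \<open>p\<close> by the component of \<open>x - p\<close> along \<open>s\<close> would shorten the distance.\<close>
    define t where "t = ((x - p) \<bullet> s) / (s \<bullet> s)"
    have "p + t *\<^sub>R s \<in> S" using \<open>p \<in> S\<close> that assms(1) by (simp add: subspace_add subspace_scale)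
    then have "?Q p \<le> ?Q (p + t *\<^sub>R s)" using D_le \<open>?Q p \<le> D\<close> order_trans by blast
    moreover have "?Q (p + t *\<^sub>R s) = ?Q p - 2 * t * ((x - p) \<bullet> s) + t\<^sup>2 * (s \<bullet> s)"
      unfolding power2_norm_eq_inner
      by (simp add: inner_add_left inner_add_right inner_diff_left inner_diff_right
          inner_commute algebra_simps power2_eq_square)
    moreover have "(x - p) \<bullet> s = t * (s \<bullet> s)" using False by (simp add: t_def)
    ultimately have "t\<^sup>2 * (s \<bullet> s) \<le> 0" by (simp add: power2_eq_square)
    then have "t = 0"
      using False by (metis inner_gt_zero_iff mult_le_0_iff not_le zero_less_power2)
    then show ?thesis using \<open>(x - p) \<bullet> s = t * (s \<bullet> s)\<close> by simp
  qed simp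
  then show thesis using that \<open>p \<in> S\<close> by blast
qed

text \<open>
  For \<open>f \<noteq> 0\<close> the representing vector is a multiple of any \<open>u \<noteq> 0\<close> orthogonal to the kernel of \<open>f\<close>, because
  \<open>y - (f y / f u) *\<^sub>R u\<close> is always in the kernel.
\<close>

lemma Riesz_representation:
  fixes f :: "'a :: {real_inner, complete_space} \<Rightarrow> real"
  assumes "bounded_linear f"
  obtains z where "\<And>x. f x = x \<bullet> z"
proof (cases "\<forall>x. f x = 0")
  case True
  then show thesis using that[of 0] by simp
next
  case False
  then obtain x where x: "f x \<noteq> 0" by blast
  interpret f: bounded_linear f by fact
  let ?K = "{y. f y = 0}"
  have "subspace ?K" by (auto simp: subspace_def f.add f.scaleR f.zero)
  moreover have "closed ?K"
    by (intro closed_Collect_eq continuous_intros f.continuous_on)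
  ultimately obtain p where p: "p \<in> ?K" "\<And>s. s \<in> ?K \<Longrightarrow> (x - p) \<bullet> s = 0"
    using orthogonal_projection_exists[of ?K x] by blast
  define u where "u = x - p"
  have fu: "f u = f x" using p(1) by (simp add: u_def f.diff)
  then have "u \<noteq> 0" using x f.zero by auto
  have "f y = y \<bullet> ((f u / (u \<bullet> u)) *\<^sub>R u)" for y
  proof -
    have "y - (f y / f u) *\<^sub>R u \<in> ?K" using x fu by (simp add: f.diff f.scaleR)
    then have "u \<bullet> (y - (f y / f u) *\<^sub>R u) = 0" unfolding u_def by (rule p(2))
    then have "u \<bullet> y = (f y / f u) * (u \<bullet> u)" by (simp add: inner_diff_right)
    then show ?thesis using x fu \<open>u \<noteq> 0\<close> by (simp add: inner_commute)
  qed
  then show thesis by (rule that)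
qed

section \<open>The open mapping theorem for operators with closed range\<close>

text \<open>
  By Baire's theorem in the complete space \<open>range f\<close>, the closure of the image of some ball
  has interior points relative to \<open>range f\<close>. Translating such a point to the origin shows that
  every \<open>y\<close> in the range is approximated, to any accuracy, by images of vectors of norm at
  most a multiple of \<open>norm y\<close>.
\<close>

lemma closed_range_approximate_preimage:
  fixes f :: "'a :: banach \<Rightarrow> 'b :: banach"
  assumes "bounded_linear f" and "closed (range f)"
  obtains C where "C > 0"
    and "\<And>y d. y \<in> range f \<Longrightarrow> d > 0 \<Longrightarrow> \<exists>x. norm x \<le> C * norm y \<and> norm (y - f x) < d"
proof -
  interpret f: bounded_linear f by fact
  let ?Y = "range f"
  let ?X = "top_of_set ?Y"
  have subY: "subspace ?Y" by (simp add: linear_subspace_image f.linear_axioms)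
  define A where "A n = closure (f ` cball 0 (real n))" for n
  have AY: "A n \<subseteq> ?Y" for n
    unfolding A_def using assms(2) by (intro closure_minimal) auto
  have cm: "completely_metrizable_space ?X"
    using assms(2)
    by (simp add: completely_metrizable_space_closedin completely_metrizable_space_euclidean)
  have union: "\<Union>(range A) = ?Y"
  proof
    show "?Y \<subseteq> \<Union>(range A)"
    proof
      fix y assume "y \<in> ?Y"
      then obtain x where "y = f x" by auto
      moreover obtain n where "norm x \<le> real n" using real_arch_simple by blast
      ultimately have "y \<in> f ` cball 0 (real n)" by auto
      then have "y \<in> A n" unfolding A_def by (rule subsetD[OF closure_subset])
      then show "y \<in> \<Union>(range A)" by blast
    qed
  qed (use AY in auto)
  have "\<exists>n. ?X interior_of A n \<noteq> {}"
  proof (rule ccontr)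
    assume "\<not> ?thesis"
    then have int: "?X interior_of A n = {}" for n by blast
    have closed: "closedin ?X (A n)" for n
      using AY unfolding A_def by (rule closed_subset) simp
    have "?X interior_of \<Union>(range A) = {}"
    proof (rule Baire_category_alt)
      fix B assume "B \<in> range A"
      then show "closedin ?X B \<and> ?X interior_of B = {}" using closed int by blast
    qed (use cm in simp_all)
    then have "?X interior_of topspace ?X = {}" by (simp only: union topspace_euclidean_subtopology)
    then have "topspace ?X = {}" by (simp only: interior_of_topspace)
    then have "?Y = {}" by simp
    then show False by blast
  qed
  then obtain n y0 where "y0 \<in> ?X interior_of A n" by blast
  then obtain U where U: "openin ?X U" "y0 \<in> U" "U \<subseteq> A n" by (auto simp: interior_of_def)
  then have "\<exists>e>0. ball y0 e \<inter> ?Y \<subseteq> U"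
    using iffD1[OF openin_contains_ball U(1)] by simp
  then obtain e where e: "e > 0" "ball y0 e \<inter> ?Y \<subseteq> U" by blast
  have "y0 \<in> ?Y" using U AY by blast
  have near: "\<exists>x. norm x \<le> real n \<and> norm (y - f x) < d" if y: "y \<in> A n" and d: "d > 0" for y d
  proof -
    obtain z where "z \<in> f ` cball 0 (real n)" "dist z y < d"
      using y d unfolding A_def closure_approachable by blast
    then show ?thesis by (auto simp: dist_norm norm_minus_commute)
  qed
  \<comment> \<open>A small \<open>y\<close> in the range is the difference of the two points \<open>y0 + y\<close> and \<open>y0\<close> of
    the closure, so preimages of norm at most \<open>2 * n\<close> suffice for it.\<close>
  have small: "\<exists>x. norm x \<le> 2 * real n \<and> norm (y - f x) < d"
    if y: "y \<in> ?Y" "norm y < e" and d: "d > 0" for y d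
  proof -
    have "y0 + y \<in> ?Y" using subspace_add[OF subY \<open>y0 \<in> ?Y\<close> y(1)] .
    moreover have "y0 + y \<in> ball y0 e" using y(2) by (simp add: dist_norm)
    ultimately have "y0 + y \<in> A n" using e U by blast
    then obtain a where a: "norm a \<le> real n" "norm (y0 + y - f a) < d / 2"
      using near[of "y0 + y" "d/2"] d by auto
    have "y0 \<in> A n" using U by blast
    then obtain b where b: "norm b \<le> real n" "norm (y0 - f b) < d / 2"
      using near[of y0 "d/2"] d by auto
    have eq: "y - f (a - b) = (y0 + y - f a) - (y0 - f b)" by (simp add: f.diff)
    have "norm (y - f (a - b)) < d"
      unfolding eq using norm_triangle_ineq4[of "y0 + y - f a" "y0 - f b"] a b by linarith
    moreover have "norm (a - b) \<le> 2 * real n" using norm_triangle_ineq4[of a b] a b by simp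
    ultimately show ?thesis by blast
  qed
  define C where "C = 4 * real n / e + 1"
  show thesis
  proof (rule that)
    show "C > 0" unfolding C_def using e(1) by (simp add: add_nonneg_pos)
  next
    fix y and d :: real assume y: "y \<in> ?Y" and d: "d > 0"
    show "\<exists>x. norm x \<le> C * norm y \<and> norm (y - f x) < d"
    proof (cases "y = 0")
      case True
      then show ?thesis using d f.zero by (intro exI[of _ 0]) simp
    next
      case False
      \<comment> \<open>Rescale \<open>y\<close> to norm \<open>e / 2\<close>.\<close>
      define t where "t = e / (2 * norm y)"
      have t: "t > 0" using e(1) False by (simp add: t_def)
      have "t *\<^sub>R y \<in> ?Y" using subspace_scale[OF subY y] .
      moreover have "norm (t *\<^sub>R y) < e" using t False e(1) by (simp add: t_def)
      ultimately obtain x where x: "norm x \<le> 2 * real n" "norm (t *\<^sub>R y - f x) < t * d"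
        using small[of "t *\<^sub>R y" "t * d"] t d by auto
      let ?x = "(1 / t) *\<^sub>R x"
      have "norm ?x \<le> (1 / t) * (2 * real n)" using x(1) t by (simp add: divide_right_mono)
      also have "\<dots> = (4 * real n / e) * norm y" using e(1) False by (simp add: t_def field_simps)
      also have "\<dots> \<le> C * norm y" unfolding C_def by (intro mult_right_mono) auto
      finally have "norm ?x \<le> C * norm y" .
      moreover have eq: "y - f ?x = (1 / t) *\<^sub>R (t *\<^sub>R y - f x)"
        using t by (simp add: f.scaleR scaleR_diff_right)
      have "norm (y - f ?x) < d" unfolding eq norm_scaleR using x(2) t by (simp add: field_simps)
      ultimately show ?thesis by blast
    qed
  qed
qed

text \<open>
  The approximate preimages become exact: taking the accuracy \<open>norm y / 2\<close> and correcting the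
  remaining error again and again gives a geometrically convergent series.
\<close>

lemma closed_range_bounded_preimage:
  fixes f :: "'a :: banach \<Rightarrow> 'b :: banach"
  assumes "bounded_linear f" and "closed (range f)"
  obtains C where "C > 0" and "\<And>y. y \<in> range f \<Longrightarrow> \<exists>x. f x = y \<and> norm x \<le> C * norm y"
proof -
  interpret f: bounded_linear f by fact
  obtain C where C: "C > 0"
    and app: "\<And>y d. y \<in> range f \<Longrightarrow> d > 0 \<Longrightarrow> \<exists>x. norm x \<le> C * norm y \<and> norm (y - f x) < d"
    using closed_range_approximate_preimage[OF assms] by blast
  have "\<exists>x. norm x \<le> C * norm y \<and> norm (y - f x) \<le> norm y / 2" if "y \<in> range f" for y
  proof (cases "y = 0")
    case True
    then show ?thesis using f.zero by (intro exI[of _ 0]) simp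
  next
    case False
    then show ?thesis using app[OF that, of "norm y / 2"] by (auto intro: less_imp_le)
  qed
  then obtain g where g: "\<And>y. y \<in> range f \<Longrightarrow> norm (g y) \<le> C * norm y"
    "\<And>y. y \<in> range f \<Longrightarrow> norm (y - f (g y)) \<le> norm y / 2"
    by metis
  have "\<exists>x. f x = y \<and> norm x \<le> 2 * C * norm y" if y: "y \<in> range f" for y
  proof -
    define r where "r k = ((\<lambda>z. z - f (g z)) ^^ k) y" for k
    have r_0: "r 0 = y" and r_Suc: "r (Suc k) = r k - f (g (r k))" for k
      by (simp_all add: r_def)
    have r_range: "r k \<in> range f" for k
      by (induction k) (use y in \<open>auto simp: r_0 r_Suc simp flip: f.diff\<close>)
    have r_norm: "norm (r k) \<le> norm y * (1/2) ^ k" for k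
    proof (induction k)
      case (Suc k)
      then show ?case using g(2)[OF r_range[of k]] by (simp add: r_Suc)
    qed (simp add: r_0)
    have half: "(\<lambda>k. C * norm y * (1/2) ^ k) sums (2 * C * norm y)"
      using sums_mult[OF geometric_sums[of "1/2 :: real"], of "C * norm y"] by (simp add: mult_ac)
    have g_norm: "norm (g (r k)) \<le> C * norm y * (1/2) ^ k" for k
    proof -
      have "norm (g (r k)) \<le> C * norm (r k)" by (rule g(1)[OF r_range])
      also have "\<dots> \<le> C * (norm y * (1/2) ^ k)" using C r_norm by (intro mult_left_mono) auto
      finally show ?thesis by (simp add: mult_ac)
    qed
    have summ: "summable (\<lambda>k. norm (g (r k)))"
      by (rule summable_comparison_test'[OF sums_summable[OF half], of 0]) (use g_norm in auto)
    let ?x = "\<Sum>k. g (r k)"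
    have "norm ?x \<le> (\<Sum>k. norm (g (r k)))" by (rule summable_norm[OF summ])
    also have "\<dots> \<le> (\<Sum>k. C * norm y * (1/2) ^ k)"
      by (rule suminf_le[OF g_norm summ sums_summable[OF half]])
    also have "\<dots> = 2 * C * norm y" using half by (simp add: sums_iff)
    finally have "norm ?x \<le> 2 * C * norm y" .
    moreover have "f ?x = y"
    proof -
      have "(\<lambda>k. g (r k)) sums ?x" using summable_norm_cancel[OF summ] by (rule summable_sums)
      then have "(\<lambda>k. f (g (r k))) sums f ?x" by (rule f.sums)
      moreover have "(\<lambda>k. norm y * (1/2) ^ k) \<longlonglongrightarrow> norm y * 0"
        by (intro tendsto_mult tendsto_const LIMSEQ_power_zero) simp
      then have "r \<longlonglongrightarrow> 0"
        by (intro Lim_null_comparison[OF always_eventually[OF allI[OF r_norm]]]) simp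
      then have "(\<lambda>k. r k - r (Suc k)) sums (r 0 - 0)" by (rule telescope_sums')
      then have "(\<lambda>k. f (g (r k))) sums y" by (simp add: r_Suc r_0)
      ultimately show ?thesis by (rule sums_unique2)
    qed
    ultimately show ?thesis by blast
  qed
  then show thesis using that[of "2 * C"] C by auto
qed

section \<open>Complex subspaces and their orthogonal complements\<close>

lemma scaleC_diff_right: "c *\<^sub>C (x - y) = c *\<^sub>C x - c *\<^sub>C (y :: 'a :: complex_inner)"
  using scaleC_add_right[of c "x - y" y] by (simp add: algebra_simps)

lemma scaleC_zero_left [simp]: "0 *\<^sub>C x = (0 :: 'a :: complex_inner)"
  using scaleC_add_left[of 0 0 x] by simp

lemma scaleC_zero_right [simp]: "c *\<^sub>C 0 = (0 :: 'a :: complex_inner)"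
  using scaleC_add_right[of c 0 0] by simp

lemma cinner_scaleC_right: "cinner x (c *\<^sub>C y) = cnj c * cinner x y"
  by (metis cinner_commute cinner_scaleC_left complex_cnj_mult)

lemma cinner_zero_left [simp]: "cinner 0 y = 0"
  using cinner_add_left[of 0 0 y] by simp

lemma norm_scaleC: "norm (c *\<^sub>C x) = cmod c * norm (x :: 'a :: complex_inner)"
proof -
  have "complex_of_real ((norm (c *\<^sub>C x))\<^sup>2) = c * cnj c * complex_of_real ((norm x)\<^sup>2)"
    unfolding cinner_self_eq_norm[symmetric]
    by (simp add: cinner_scaleC_left cinner_scaleC_right mult.assoc)
  also have "\<dots> = complex_of_real ((cmod c * norm x)\<^sup>2)"
    unfolding complex_norm_square[symmetric] by (simp add: power_mult_distrib)
  finally have "(norm (c *\<^sub>C x))\<^sup>2 = (cmod c * norm x)\<^sup>2" using of_real_eq_iff by blast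
  then show ?thesis by (simp add: power2_eq_iff_nonneg)
qed

text \<open>
  Complex inner products are determined by real ones, since
  \<open>Im (cinner x y) = - Re (cinner (\<i> *\<^sub>C x) y)\<close>. This carries the real theory over.
\<close>

lemma cinner_eqI_inner:
  fixes x y x' y' :: "'a :: complex_inner"
  assumes "\<And>c. (c *\<^sub>C x) \<bullet> y = (c *\<^sub>C x') \<bullet> y'"
  shows "cinner x y = cinner x' y'"
proof -
  have "Re (c * cinner x y) = Re (c * cinner x' y')" for c
    using assms[of c] by (simp add: inner_eq_Re_cinner cinner_scaleC_left)
  from this[of 1] this[of \<i>] show ?thesis by (simp add: complex_eq_iff)
qed

definition complex_subspace :: "'a :: complex_inner set \<Rightarrow> bool" where
  "complex_subspace M \<longleftrightarrow> subspace M \<and> (\<forall>c. \<forall>x\<in>M. c *\<^sub>C x \<in> M)"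

lemma complex_subspace_subspace: "complex_subspace M \<Longrightarrow> subspace M"
  and complex_subspace_scaleC: "complex_subspace M \<Longrightarrow> x \<in> M \<Longrightarrow> c *\<^sub>C x \<in> M"
  unfolding complex_subspace_def by auto

lemma complex_subspace_UNIV: "complex_subspace UNIV"
  by (simp add: complex_subspace_def)

lemma complex_subspace_ortho_compl: "complex_subspace (ortho_compl M)"
  by (auto simp: complex_subspace_def subspace_def ortho_compl_def cinner_add_left
      cinner_scaleC_left scaleR_scaleC)

lemma ortho_compl_eq_inner:
  assumes "complex_subspace N"
  shows "ortho_compl N = {x. \<forall>y\<in>N. x \<bullet> y = 0}"
proof
  show "ortho_compl N \<subseteq> {x. \<forall>y\<in>N. x \<bullet> y = 0}"
    by (auto simp: ortho_compl_def inner_eq_Re_cinner)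
  show "{x. \<forall>y\<in>N. x \<bullet> y = 0} \<subseteq> ortho_compl N"
  proof
    fix x assume x: "x \<in> {x. \<forall>y\<in>N. x \<bullet> y = 0}"
    have "cinner x y = 0" if "y \<in> N" for y
    proof -
      have "Re (cinner x (c *\<^sub>C y)) = 0" for c
        using x complex_subspace_scaleC[OF assms that] by (auto simp: inner_eq_Re_cinner)
      then have "Re (cnj c * cinner x y) = 0" for c by (simp add: cinner_scaleC_right)
      from this[of 1] this[of \<i>] show ?thesis by (simp add: complex_eq_iff)
    qed
    then show "x \<in> ortho_compl N" by (simp add: ortho_compl_def)
  qed
qed

lemma closed_ortho_compl:
  assumes "complex_subspace N"
  shows "closed (ortho_compl N)"
proof -
  have "ortho_compl N = (\<Inter>y\<in>N. {x. x \<bullet> y = 0})"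
    using ortho_compl_eq_inner[OF assms] by auto
  moreover have "closed {x. x \<bullet> y = 0}" for y :: 'a
    by (intro closed_Collect_eq continuous_intros)
  ultimately show ?thesis by auto
qed

lemma ortho_compl_decomposition:
  fixes N :: "'a :: complex_hilbert set"
  assumes "complex_subspace N" and "closed N"
  obtains n m where "z = n + m" and "n \<in> N" and "m \<in> ortho_compl N"
proof -
  obtain p where p: "p \<in> N" "\<And>s. s \<in> N \<Longrightarrow> (z - p) \<bullet> s = 0"
    using orthogonal_projection_exists[OF complex_subspace_subspace[OF assms(1)] assms(2)] by blast
  then show thesis
    using that[of p "z - p"] ortho_compl_eq_inner[OF assms(1)] by simp
qed

section \<open>Operators and adjoints\<close>

instance complex_hilbert \<subseteq> banach ..

lemma operator_bounded_linear: "operator T \<Longrightarrow> bounded_linear T"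
  and operator_scaleC: "operator T \<Longrightarrow> T (c *\<^sub>C x) = c *\<^sub>C T x"
  by (auto simp: operator_on_UNIV_iff)

lemma adjoint_unique:
  fixes S S' :: "'a :: complex_inner \<Rightarrow> 'a"
  assumes "\<And>x y. cinner (T x) y = cinner x (S y)" and "\<And>x y. cinner (T x) y = cinner x (S' y)"
  shows "S = S'"
proof
  fix y
  have "x \<bullet> S y = x \<bullet> S' y" for x
    using assms by (metis inner_eq_Re_cinner)
  then show "S y = S' y" using vector_eq_ldot by blast
qed

text \<open>
  Uniqueness of the representing vectors makes the adjoint additive and homogeneous; its bound is that of \<open>T\<close>,
  because \<open>(norm (S y))\<^sup>2 = T (S y) \<bullet> y\<close>.
\<close>

lemma adjoint_exists:
  fixes T :: "'a :: complex_hilbert \<Rightarrow> 'a"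
  assumes "operator T"
  obtains S where "operator S" and "\<And>x y. cinner (T x) y = cinner x (S y)"
proof -
  interpret T: bounded_linear T using assms by (rule operator_bounded_linear)
  have "\<exists>z. \<forall>x. T x \<bullet> y = x \<bullet> z" for y
  proof -
    have "bounded_linear (\<lambda>x. T x \<bullet> y)"
      by (rule bounded_linear_compose[OF bounded_linear_inner_left T.bounded_linear_axioms])
    then show ?thesis by (metis Riesz_representation)
  qed
  then obtain S where S: "\<And>x y. T x \<bullet> y = x \<bullet> S y" by metis
  have cS: "cinner (T x) y = cinner x (S y)" for x y
    by (rule cinner_eqI_inner) (simp add: S flip: operator_scaleC[OF assms])
  have add: "S (x + y) = S x + S y" for x y
  proof -
    have "z \<bullet> S (x + y) = z \<bullet> (S x + S y)" for z
      by (simp add: inner_add_right flip: S)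
    then show ?thesis using vector_eq_ldot by blast
  qed
  have scale: "S (c *\<^sub>C x) = c *\<^sub>C S x" for c x
  proof -
    have "cinner z (S (c *\<^sub>C x)) = cinner z (c *\<^sub>C S x)" for z
      by (simp add: cinner_scaleC_right flip: cS)
    then have "z \<bullet> S (c *\<^sub>C x) = z \<bullet> (c *\<^sub>C S x)" for z by (simp add: inner_eq_Re_cinner)
    then show ?thesis using vector_eq_ldot by blast
  qed
  obtain K where K: "\<And>x. norm (T x) \<le> norm x * K" using T.bounded by blast
  have bound: "norm (S y) \<le> K * norm y" for y
  proof (cases "S y = 0")
    case True
    have "0 \<le> norm (T y)" by simp
    also have "\<dots> \<le> K * norm y" using K[of y] by (simp add: mult.commute)
    finally show ?thesis using True by simp
  next
    case False
    have "norm (S y) * norm (S y) = T (S y) \<bullet> y"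
      by (simp add: S flip: power2_norm_eq_inner power2_eq_square)
    also have "\<dots> \<le> norm (T (S y)) * norm y" by (rule norm_cauchy_schwarz)
    also have "\<dots> \<le> norm (S y) * K * norm y" using K by (intro mult_right_mono) auto
    finally show ?thesis using False by simp
  qed
  have "operator S"
    unfolding operator_on_def using add scale bound by auto
  then show thesis using that cS by blast
qed

lemma hadjoint_eqI:
  assumes "operator S" and "\<And>x y. cinner (T x) y = cinner x (S y)"
  shows "hadjoint T = S"
  unfolding hadjoint_def
proof (rule the_equality)
  show "operator S \<and> (\<forall>x y. cinner (T x) y = cinner x (S y))" using assms by blast
next
  fix S' assume "operator S' \<and> (\<forall>x y. cinner (T x) y = cinner x (S' y))"
  then show "S' = S" using adjoint_unique[of T S' S] assms by blast
qed

lemma operator_hadjoint: "operator T \<Longrightarrow> operator (hadjoint T)"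
  and cinner_hadjoint: "operator T \<Longrightarrow> cinner (T x) y = cinner x (hadjoint T y)"
  by (metis adjoint_exists hadjoint_eqI)+

lemma hadjoint_hadjoint:
  assumes "operator T"
  shows "hadjoint (hadjoint T) = T"
proof (rule hadjoint_eqI[OF assms])
  show "cinner (hadjoint T x) y = cinner x (T y)" for x y
    by (metis assms cinner_commute cinner_hadjoint)
qed

lemma complex_subspace_null_space: "operator T \<Longrightarrow> complex_subspace (null_space T)"
  unfolding complex_subspace_def null_space_def
  using bounded_linear.linear[OF operator_bounded_linear[of T]]
  by (simp add: linear_subspace_kernel operator_scaleC)

lemma complex_subspace_range:
  assumes "operator T"
  shows "complex_subspace (range T)"
proof -
  have "subspace (range T)"
    using bounded_linear.linear[OF operator_bounded_linear[OF assms]]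
    by (simp add: linear_subspace_image)
  moreover have "c *\<^sub>C T x \<in> range T" for c x
    by (metis assms operator_scaleC rangeI)
  ultimately show ?thesis by (auto simp: complex_subspace_def)
qed

lemma closed_null_space: "operator T \<Longrightarrow> closed (null_space T)"
  unfolding null_space_def
  by (intro closed_Collect_eq continuous_intros linear_continuous_on operator_bounded_linear)

lemma range_hadjoint_subset:
  assumes "operator T"
  shows "range (hadjoint T) \<subseteq> ortho_compl (null_space T)"
proof -
  have "cinner (hadjoint T y) x = 0" if "T x = 0" for x y
    using cinner_hadjoint[OF assms, of x y] that
    by (metis cinner_commute cinner_zero_left complex_cnj_zero)
  then show ?thesis by (auto simp: ortho_compl_def null_space_def)
qed

text \<open>
  A vector orthogonal to the range of the adjoint lies in the kernel of \<open>T\<close>. So if that range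
  is closed, its orthogonal complement within the complement of the kernel is zero.
\<close>

lemma ortho_compl_null_space_eq_range_hadjoint:
  assumes "operator T" and "closed (range (hadjoint T))"
  shows "ortho_compl (null_space T) = range (hadjoint T)"
proof
  show "range (hadjoint T) \<subseteq> ortho_compl (null_space T)"
    by (rule range_hadjoint_subset[OF assms(1)])
  show "ortho_compl (null_space T) \<subseteq> range (hadjoint T)"
  proof
    fix z assume z: "z \<in> ortho_compl (null_space T)"
    obtain p q where pq: "z = p + q" "p \<in> range (hadjoint T)" "q \<in> ortho_compl (range (hadjoint T))"
      using ortho_compl_decomposition[OF complex_subspace_range[OF operator_hadjoint[OF assms(1)]]
          assms(2)] by blast
    have "cinner (T q) (T q) = 0"
      using pq(3) by (auto simp: cinner_hadjoint[OF assms(1)] ortho_compl_def)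
    then have "q \<in> null_space T" by (simp add: cinner_self_eq_norm null_space_def)
    moreover have "q = z - p" using pq(1) by simp
    then have "q \<in> ortho_compl (null_space T)"
      using z pq(2) range_hadjoint_subset[OF assms(1)]
      by (metis complex_subspace_ortho_compl complex_subspace_subspace subspace_diff subsetD)
    ultimately have "cinner q q = 0" by (auto simp: ortho_compl_def)
    then have "q = 0" by (simp add: cinner_self_eq_norm)
    then show "z \<in> range (hadjoint T)" using pq by simp
  qed
qed

section \<open>Invertibility\<close>

lemma invertible_on_imp_image: "invertible_on M S \<Longrightarrow> S ` M = M"
proof -
  assume "invertible_on M S"
  then obtain R where R: "S ` M \<subseteq> M" "R ` M \<subseteq> M" "\<And>x. x \<in> M \<Longrightarrow> S (R x) = x"
    unfolding invertible_on_def operator_on_def by auto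
  have "x \<in> S ` M" if "x \<in> M" for x using R that by (metis image_eqI image_subset_iff)
  then show ?thesis using R(1) by blast
qed

lemma invertible_onI:
  assumes M: "complex_subspace M" and S: "operator_on M S" and onto: "S ` M = M"
    and c: "c > 0" and low: "\<And>x. x \<in> M \<Longrightarrow> c * norm x \<le> norm (S x)"
  shows "invertible_on M S"
proof -
  have add: "S (x + y) = S x + S y" if "x \<in> M" "y \<in> M" for x y
    using S that by (auto simp: operator_on_def)
  have scale: "S (a *\<^sub>C x) = a *\<^sub>C S x" if "x \<in> M" for a x
    using S that by (auto simp: operator_on_def)
  note sub = complex_subspace_subspace[OF M]
  have inj: "x = y" if "x \<in> M" "y \<in> M" "S x = S y" for x y
  proof -
    have "S x = S ((x - y) + y)" by simp
    also have "\<dots> = S (x - y) + S y" using that sub by (intro add subspace_diff)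
    finally have "S (x - y) = 0" using that(3) by simp
    then have "c * norm (x - y) \<le> 0" using low[of "x - y"] that sub by (simp add: subspace_diff)
    then show ?thesis using c by (simp add: mult_le_0_iff)
  qed
  define R where "R = inv_into M S"
  have RM: "R y \<in> M" and SR: "S (R y) = y" if "y \<in> M" for y
    using that onto by (simp_all add: R_def inv_into_into f_inv_into_f)
  have RS: "R (S x) = x" if "x \<in> M" for x
  proof -
    have "S x \<in> M" using that onto by blast
    then show ?thesis using that by (intro inj[of "R (S x)" x] RM SR)
  qed
  have "operator_on M R"
    unfolding operator_on_def
  proof (intro conjI ballI allI exI)
    show "R ` M \<subseteq> M" using RM by blast
  next
    fix x y assume "x \<in> M" "y \<in> M"
    note xy = this sub
    show "R (x + y) = R x + R y"
      by (rule inj) (use xy in \<open>simp_all add: RM SR add subspace_add\<close>)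
  next
    fix a x assume x: "x \<in> M"
    show "R (a *\<^sub>C x) = a *\<^sub>C R x"
      by (rule inj) (use x M in \<open>simp_all add: RM SR scale complex_subspace_scaleC\<close>)
  next
    fix x assume "x \<in> M"
    then have "c * norm (R x) \<le> norm x" using low[OF RM] SR by metis
    then show "norm (R x) \<le> (1 / c) * norm x" using c by (simp add: field_simps)
  qed
  then show ?thesis unfolding invertible_on_def using S RS SR by blast
qed

lemma invertible_on_UNIV_bij:
  fixes S :: "'a :: complex_hilbert \<Rightarrow> 'a"
  assumes "operator S" and "bij S"
  shows "invertible_on UNIV S"
proof -
  have surj: "range S = UNIV" using assms(2) by (simp add: bij_is_surj)
  then have "closed (range S)" by simp
  then obtain C where C: "C > 0" "\<And>y. y \<in> range S \<Longrightarrow> \<exists>x. S x = y \<and> norm x \<le> C * norm y"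
    using closed_range_bounded_preimage[OF operator_bounded_linear[OF assms(1)]] by blast
  have "(1 / C) * norm x \<le> norm (S x)" for x
  proof -
    obtain x' where x': "S x' = S x" "norm x' \<le> C * norm (S x)" using C(2) by blast
    then have "x' = x" using injD[OF bij_is_inj[OF assms(2)]] by blast
    then have "norm x \<le> C * norm (S x)" using x'(2) by simp
    then show ?thesis using C(1) by (simp add: field_simps)
  qed
  then show ?thesis
    using invertible_onI[OF complex_subspace_UNIV assms(1) surj, of "1 / C"] C(1) by simp
qed

lemma operator_diff_scaleC:
  fixes T :: "'a :: complex_inner \<Rightarrow> 'a"
  assumes "operator T"
  shows "operator (\<lambda>x. T x - l *\<^sub>C x)"
proof -
  interpret T: bounded_linear T using assms by (rule operator_bounded_linear)
  obtain K where K: "\<And>x. norm (T x) \<le> norm x * K" using T.bounded by blast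
  have "norm (T x - l *\<^sub>C x) \<le> (K + cmod l) * norm x" for x
    using norm_triangle_ineq4[of "T x" "l *\<^sub>C x"] K[of x]
    by (simp add: norm_scaleC algebra_simps)
  then show ?thesis
    unfolding operator_on_def
    by (intro conjI exI[of _ "K + cmod l"])
      (auto simp: T.add scaleC_add_right operator_scaleC[OF assms] scaleC_diff_right
        scaleC_scaleC mult.commute)
qed

section \<open>Restriction to the orthogonal complement of the kernel\<close>

text \<open>
  Among all preimages of a vector the one orthogonal to the kernel has the least norm, so the
  bounded preimages of the open mapping theorem give a lower bound there.
\<close>

lemma lower_bound_on_ortho_compl_null_space:
  fixes T :: "'a :: complex_hilbert \<Rightarrow> 'a"
  assumes "operator T" and "closed (range T)"
  obtains c where "c > 0" and "\<And>m. m \<in> ortho_compl (null_space T) \<Longrightarrow> c * norm m \<le> norm (T m)"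
proof -
  interpret T: bounded_linear T using assms(1) by (rule operator_bounded_linear)
  obtain C where C: "C > 0" "\<And>y. y \<in> range T \<Longrightarrow> \<exists>x. T x = y \<and> norm x \<le> C * norm y"
    using closed_range_bounded_preimage[OF T.bounded_linear_axioms assms(2)] by blast
  have "(1 / C) * norm m \<le> norm (T m)" if m: "m \<in> ortho_compl (null_space T)" for m
  proof -
    obtain x where x: "T x = T m" "norm x \<le> C * norm (T m)" using C(2) by blast
    have "x - m \<in> null_space T" using x(1) by (simp add: null_space_def T.diff)
    then have "m \<bullet> (x - m) = 0"
      using m ortho_compl_eq_inner[OF complex_subspace_null_space[OF assms(1)]] by auto
    then have "(norm m)\<^sup>2 = m \<bullet> x" by (simp add: inner_diff_right power2_norm_eq_inner)
    also have "\<dots> \<le> norm m * norm x" by (rule norm_cauchy_schwarz)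
    finally have "norm m \<le> norm x"
      by (cases "m = 0") (simp_all add: power2_eq_square)
    then show ?thesis using x(2) C(1) by (simp add: field_simps)
  qed
  then show thesis using that[of "1 / C"] C(1) by auto
qed

lemma image_ortho_compl_null_space:
  fixes T :: "'a :: complex_hilbert \<Rightarrow> 'a"
  assumes "operator T"
  shows "T ` ortho_compl (null_space T) = range T"
proof -
  interpret T: bounded_linear T using assms by (rule operator_bounded_linear)
  have "T z \<in> T ` ortho_compl (null_space T)" for z
  proof -
    obtain n m where nm: "z = n + m" "n \<in> null_space T" "m \<in> ortho_compl (null_space T)"
      using ortho_compl_decomposition[OF complex_subspace_null_space[OF assms]
          closed_null_space[OF assms]] by blast
    then have "T z = T m" by (simp add: T.add null_space_def)
    then show ?thesis using nm by blast
  qed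
  then show ?thesis by auto
qed

lemma inj_on_ortho_compl_null_space:
  fixes T :: "'a :: complex_hilbert \<Rightarrow> 'a"
  assumes "operator T"
  shows "inj_on T (ortho_compl (null_space T))"
proof (rule inj_onI)
  interpret T: bounded_linear T using assms by (rule operator_bounded_linear)
  fix x y assume xy: "x \<in> ortho_compl (null_space T)" "y \<in> ortho_compl (null_space T)" "T x = T y"
  have "x - y \<in> ortho_compl (null_space T)"
    using xy complex_subspace_ortho_compl complex_subspace_subspace subspace_diff by blast
  moreover have "x - y \<in> null_space T" using xy(3) by (simp add: null_space_def T.diff)
  ultimately have "cinner (x - y) (x - y) = 0" by (auto simp: ortho_compl_def)
  then show "x = y" by (simp add: cinner_self_eq_norm)
qed

lemma invertible_on_ortho_compl_iff:
  fixes T :: "'a :: complex_hilbert \<Rightarrow> 'a"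
  assumes "operator T" and "closed (range T)" and "range T \<subseteq> ortho_compl (null_space T)"
  shows "invertible_on (ortho_compl (null_space T)) T \<longleftrightarrow> range T = ortho_compl (null_space T)"
    (is "invertible_on ?M T \<longleftrightarrow> _")
proof
  assume "invertible_on ?M T"
  then show "range T = ?M"
    using invertible_on_imp_image image_ortho_compl_null_space[OF assms(1)] by metis
next
  assume onto: "range T = ?M"
  obtain c where c: "c > 0" "\<And>m. m \<in> ?M \<Longrightarrow> c * norm m \<le> norm (T m)"
    using lower_bound_on_ortho_compl_null_space[OF assms(1,2)] by blast
  have "operator_on ?M T" using assms(1,3) by (auto simp: operator_on_def)
  then show "invertible_on ?M T"
    using c image_ortho_compl_null_space[OF assms(1)] onto
    by (intro invertible_onI[OF complex_subspace_ortho_compl]) auto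
qed

lemma zero_notin_residual_spectrum_iff:
  fixes T :: "'a :: complex_hilbert \<Rightarrow> 'a"
  assumes "operator T" and "closed (range T)" and "range T \<subseteq> ortho_compl (null_space T)"
  shows "0 \<notin> residual_spectrum_on (ortho_compl (null_space T)) T
    \<longleftrightarrow> range T = ortho_compl (null_space T)"
  using assms(2,3) inj_on_ortho_compl_null_space[OF assms(1)]
  by (auto simp: residual_spectrum_on_def image_ortho_compl_null_space[OF assms(1)])

text \<open>
  Posinormality and coposinormality together make the ranges of \<open>T\<close> and its adjoint equal, so
  that the range of the adjoint is closed as well.
\<close>

lemma coposinormal_iff_range_eq_ortho_compl:
  fixes T :: "'a :: complex_hilbert \<Rightarrow> 'a"
  assumes "operator T" and "posinormal T" and "closed (range T)"
  shows "coposinormal T \<longleftrightarrow> range T = ortho_compl (null_space T)"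
proof
  assume "coposinormal T"
  then have "range T = range (hadjoint T)"
    using assms(2) unfolding coposinormal_def posinormal_def hadjoint_hadjoint[OF assms(1)] by blast
  then show "range T = ortho_compl (null_space T)"
    using ortho_compl_null_space_eq_range_hadjoint[OF assms(1)] assms(3) by simp
next
  assume "range T = ortho_compl (null_space T)"
  then show "coposinormal T"
    using range_hadjoint_subset[OF assms(1)]
    unfolding coposinormal_def posinormal_def hadjoint_hadjoint[OF assms(1)] by simp
qed

section \<open>Zero as a limit point of the spectrum\<close>

text \<open>
  No vector \<open>y\<close> of the complement is missed by the range, since each is a limit of vectors \<open>T x\<close>
  with \<open>T x - t *\<^sub>R x = y\<close> for small \<open>t > 0\<close>: by the lower bound of \<open>T\<close> these solutions stay
  bounded as \<open>t\<close> tends to \<open>0\<close>.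
\<close>

lemma zero_not_limpt_spectrum_imp_range:
  fixes T :: "'a :: complex_hilbert \<Rightarrow> 'a"
  assumes "operator T" and "closed (range T)" and "range T \<subseteq> ortho_compl (null_space T)"
    and "\<not> 0 islimpt spectrum T"
  shows "range T = ortho_compl (null_space T)" (is "_ = ?M")
proof
  show "?M \<subseteq> range T"
  proof
    fix y assume y: "y \<in> ?M"
    obtain e where e: "e > 0" "\<And>l. l \<noteq> 0 \<Longrightarrow> cmod l < e \<Longrightarrow> l \<notin> spectrum T"
      using assms(4) unfolding islimpt_approachable by auto
    obtain c where c: "c > 0" "\<And>m. m \<in> ?M \<Longrightarrow> c * norm m \<le> norm (T m)"
      using lower_bound_on_ortho_compl_null_space[OF assms(1,2)] by blast
    have "\<exists>w\<in>range T. dist w y < d" if d: "d > 0" for d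
    proof -
      \<comment> \<open>With \<open>t \<le> c / 2\<close> the lower bound \<open>c / 2\<close> remains for \<open>T - t\<close>, hence
        \<open>norm x \<le> (2 / c) * norm y\<close> for the solution below; the last bound on \<open>t\<close> then
        makes \<open>t * norm x\<close> less than \<open>d\<close>.\<close>
      define t where "t = min (e / 2) (min (c / 2) (c * d / (2 * (norm y + 1))))"
      have t: "0 < t" "t < e" "t \<le> c / 2" "t \<le> c * d / (2 * (norm y + 1))"
      proof -
      have "0 < c * d / (2 * (norm y + 1))" using c(1) d by (simp add: add_nonneg_pos)
      then show "0 < t" "t < e" "t \<le> c / 2" "t \<le> c * d / (2 * (norm y + 1))"
        unfolding t_def using e(1) c(1) by linarith+
    qed
      let ?l = "complex_of_real t"
      have "?l \<notin> spectrum T" using t by (intro e(2)) auto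
      then have "invertible_on UNIV (\<lambda>x. T x - ?l *\<^sub>C x)" by (simp add: spectrum_on_def)
      then have "y \<in> range (\<lambda>x. T x - ?l *\<^sub>C x)" using invertible_on_imp_image by blast
      then obtain x where x: "y = T x - t *\<^sub>R x" by (auto simp: scaleR_scaleC)
      \<comment> \<open>Both \<open>T x\<close> and \<open>y\<close> lie in \<open>?M\<close>, hence so does \<open>x\<close>.\<close>
      have "x = (1 / t) *\<^sub>R (T x - y)" using x t by simp
      moreover have "(1 / t) *\<^sub>R (T x - y) \<in> ?M"
        using y assms(3) complex_subspace_subspace[OF complex_subspace_ortho_compl]
        by (intro subspace_scale subspace_diff) auto
      ultimately have "c * norm x \<le> norm (T x)" using c(2) by metis
      also have "\<dots> \<le> norm y + t * norm x"
        using norm_triangle_ineq[of y "t *\<^sub>R x"] x t by simp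
      also have "t * norm x \<le> (c / 2) * norm x" using t by (intro mult_right_mono) auto
      finally have *: "c * norm x \<le> 2 * norm y" by (simp add: field_simps)
      have "t * (c * norm x) \<le> t * (2 * norm y)" using * t by (intro mult_left_mono) auto
      also have "\<dots> < t * (2 * (norm y + 1))" using t by simp
      also have "\<dots> \<le> c * d / (2 * (norm y + 1)) * (2 * (norm y + 1))"
        using t by (intro mult_right_mono) auto
      also have "\<dots> = c * d"
        using norm_ge_zero[of y] by (simp add: field_simps add_nonneg_eq_0_iff)
      finally have "t * norm x < d" using c(1) by (simp add: mult.left_commute)
      moreover have "dist (T x) y = t * norm x" using x t by (simp add: dist_norm)
      ultimately show ?thesis by (metis rangeI)
    qed
    then have "y \<in> closure (range T)" by (simp add: closure_approachable)
    then show "y \<in> range T" using assms(2) by simp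
  qed
qed (rule assms(3))

text \<open>
  Along the kernel \<open>T - l\<close> is multiplication by \<open>- l\<close>. On the complement \<open>T m - l *\<^sub>C m = y\<close>
  says that \<open>m\<close> is a fixed point of the map taking \<open>m\<close> to the preimage of \<open>y + l *\<^sub>C m\<close>, and
  this map is a contraction as soon as \<open>cmod l\<close> is below the lower bound of \<open>T\<close>.
\<close>

lemma range_imp_zero_not_limpt_spectrum:
  fixes T :: "'a :: complex_hilbert \<Rightarrow> 'a"
  assumes "operator T" and "range T = ortho_compl (null_space T)"
  shows "\<not> 0 islimpt spectrum T"
proof -
  let ?N = "null_space T" and ?M = "ortho_compl (null_space T)"
  interpret T: bounded_linear T using assms(1) by (rule operator_bounded_linear)
  note N = complex_subspace_null_space[OF assms(1)]
  note M = complex_subspace_ortho_compl[of ?N]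
  note subM = complex_subspace_subspace[OF M]
  have closedM: "closed ?M" by (rule closed_ortho_compl[OF N])
  have closed_range: "closed (range T)" unfolding assms(2) by (rule closedM)
  obtain c where c: "c > 0" "\<And>m. m \<in> ?M \<Longrightarrow> c * norm m \<le> norm (T m)"
    using lower_bound_on_ortho_compl_null_space[OF assms(1) closed_range] by blast
  have "l \<notin> spectrum T" if l: "l \<noteq> 0" "cmod l < c" for l
  proof -
    let ?S = "\<lambda>x. T x - l *\<^sub>C x"
    have opS: "operator ?S" by (rule operator_diff_scaleC[OF assms(1)])
    have TM: "T x \<in> ?M" for x using assms(2) by blast
    interpret S: bounded_linear ?S using opS by (rule operator_bounded_linear)
    have inverse_l: "(1 / l) *\<^sub>C (l *\<^sub>C x) = x" "l *\<^sub>C ((1 / l) *\<^sub>C x) = x" for x :: 'a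
      using l(1) by (simp_all add: scaleC_scaleC scaleC_one)
    have "x = 0" if "?S x = 0" for x
    proof -
      have Tx: "T x = l *\<^sub>C x" using that by simp
      have "x = (1 / l) *\<^sub>C T x" unfolding Tx by (rule inverse_l(1)[symmetric])
      also have "\<dots> \<in> ?M" by (rule complex_subspace_scaleC[OF M TM])
      finally have "c * norm x \<le> cmod l * norm x" using c(2)[of x] Tx by (simp add: norm_scaleC)
      then show "x = 0" using l(2) by (simp add: mult_le_cancel_right)
    qed
    then have "inj ?S" by (simp add: linear_injective_0[OF S.linear_axioms])
    moreover have "surj ?S"
    proof -
      have "\<exists>x. y = ?S x" for y
      proof -
        obtain n m' where nm: "y = n + m'" "n \<in> ?N" "m' \<in> ?M"
          using ortho_compl_decomposition[OF N closed_null_space[OF assms(1)]] by blast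
        define R where "R = inv_into ?M T"
        have onto: "T ` ?M = ?M" using image_ortho_compl_null_space[OF assms(1)] assms(2) by simp
        have RM: "R z \<in> ?M" and TR: "T (R z) = z" if "z \<in> ?M" for z
          using that onto by (simp_all add: R_def inv_into_into f_inv_into_f)
        have shift: "m' + l *\<^sub>C m \<in> ?M" if "m \<in> ?M" for m
          using nm(3) that by (intro subspace_add[OF subM] complex_subspace_scaleC[OF M])
        have "\<exists>!m\<in>?M. R (m' + l *\<^sub>C m) = m"
        proof (rule Banach_fix)
          show "complete ?M" using closedM by (simp add: complete_eq_closed)
          show "?M \<noteq> {}" using subspace_0[OF subM] by blast
          show "0 \<le> cmod l / c" "cmod l / c < 1" using c(1) l(2) by auto
          show "(\<lambda>m. R (m' + l *\<^sub>C m)) ` ?M \<subseteq> ?M" using RM shift by blast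
          fix u v assume uv: "u \<in> ?M" "v \<in> ?M"
          let ?d = "R (m' + l *\<^sub>C u) - R (m' + l *\<^sub>C v)"
          have "?d \<in> ?M" using uv by (intro subspace_diff[OF subM] RM shift)
          then have "c * norm ?d \<le> norm (T ?d)" by (rule c(2))
          also have "T ?d = l *\<^sub>C (u - v)" using uv by (simp add: T.diff TR shift scaleC_diff_right)
          finally show "dist (R (m' + l *\<^sub>C u)) (R (m' + l *\<^sub>C v)) \<le> cmod l / c * dist u v"
            using c(1) by (simp add: dist_norm norm_scaleC field_simps)
        qed
        then obtain m where m: "m \<in> ?M" "R (m' + l *\<^sub>C m) = m" by blast
        then have Tm: "T m = m' + l *\<^sub>C m" using TR[OF shift[OF m(1)]] by simp
        have "T ((1 / l) *\<^sub>C n) = 0"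
          using complex_subspace_scaleC[OF N nm(2)] by (simp add: null_space_def)
        then have "y = ?S (m - (1 / l) *\<^sub>C n)"
          using Tm nm(1) by (simp add: T.diff scaleC_diff_right inverse_l)
        then show ?thesis by blast
      qed
      then show ?thesis unfolding surj_def by blast
    qed
    ultimately have "invertible_on UNIV ?S" by (intro invertible_on_UNIV_bij[OF opS] bijI)
    then show ?thesis by (simp add: spectrum_on_def)
  qed
  then have "\<not> (\<exists>l\<in>spectrum T. l \<noteq> 0 \<and> dist l 0 < c)" by auto
  then show ?thesis unfolding islimpt_approachable using c(1) by blast
qed

theorem proposition3p5:
  fixes T :: "'a :: complex_hilbert \<Rightarrow> 'a"
  assumes "operator T"
    and "posinormal T"
    and "closed (range T)"
  shows "(0 \<notin> residual_spectrum_on (ortho_compl (null_space T)) T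
            \<longleftrightarrow> invertible_on (ortho_compl (null_space T)) T)
       \<and> (invertible_on (ortho_compl (null_space T)) T \<longleftrightarrow> coposinormal T)
       \<and> (coposinormal T \<longleftrightarrow> \<not> 0 islimpt spectrum T)"
proof -
  let ?M = "ortho_compl (null_space T)"
  have sub: "range T \<subseteq> ?M"
    using assms(2) range_hadjoint_subset[OF assms(1)] unfolding posinormal_def by blast
  have "\<not> 0 islimpt spectrum T \<longleftrightarrow> range T = ?M"
    using zero_not_limpt_spectrum_imp_range[OF assms(1,3) sub]
      range_imp_zero_not_limpt_spectrum[OF assms(1)] by blast
  then show ?thesis
    using zero_notin_residual_spectrum_iff[OF assms(1,3) sub]
      invertible_on_ortho_compl_iff[OF assms(1,3) sub]
      coposinormal_iff_range_eq_ortho_compl[OF assms] by blast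
qed

end
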